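(* For every integer $n\ge1$ and $r\in[0,1)$, $$\mathcal{I}_{n,r}\big(H^2,B^{1/2}_{2,2}\big)\le\Big[\big(\mathcal{C}_{n,r}(L^2_a,H^2)\big)^2+1\Big]^{1/2}\le\Big(1+r+\frac1{\sqrt n}+\frac{1-r}{n}\Big)^{1/2}\sqrt{\frac{n}{1-r}} .$$
   Context: $\mathbb{D}$ is the open unit disc, $\hat f(k)$ the $k$-th Taylor coefficient. $\|f\|_{H^2}^2=\sum_{k\ge0}|\hat f(k)|^2$; $\|f\|_{L^2_a}^2=\frac1\pi\int_{\mathbb{D}}|f|^2\,dA=\sum_{k\ge0}\frac{|\hat f(k)|^2}{k+1}$; the Dirichlet space $B^{1/2}_{2,2}=\{f:\|f\|^2_{B^{1/2}_{2,2}}=\sum_{k\ge0}(k+1)|\hat f(k)|^2<\infty\}$, so that $\|f\|^2_{B^{1/2}_{2,2}}=\|f'\|^2_{L^2_a}+\|f\|^2_{H^2}$. $\mathcal{R}_{n,r}$ is the set of rational functions $p/\prod_{j=1}^n(1-\overline{\lambda_j}z)$ with $|\lambda_j|\le r$ and $p$ a polynomial of degree $\le n-1$; $\mathcal{C}_{n,r}(X,Y)=\sup\{\|f'\|_X/\|f\|_Y: f\in\mathcal{R}_{n,r},\ f\ne0\}$. For $\lambda\in\mathbb{D}$, $b_\lambda(z)=\frac{\lambda-z}{1-\bar\lambda z}$. For a finite sequence (repetitions allowed) $\sigma=(\lambda_1,\dots,\lambda_n)$ in $\mathbb{D}$, $B_\sigma=\prod_{j=1}^n b_{\lambda_j}$,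 and for $f,g$ holomorphic on $\mathbb{D}$, "$g_{|\sigma}=f_{|\sigma}$" means $f-g\in B_\sigma\,\mathrm{Hol}(\mathbb{D})$ (interpolation with multiplicities). For spaces $X,Y$: $I(\sigma,X,Y)=\sup_{f\in X,\|f\|_X\le1}\inf\{\|g\|_Y: g\in Y,\ g_{|\sigma}=f_{|\sigma}\}$ and $\mathcal{I}_{n,r}(X,Y)=\sup\{I(\sigma,X,Y):\sigma$ has at most $n$ points (counted with multiplicity), all with $|\lambda|\le r\}$. *)

theory Defs
  imports "HOL-Analysis.Analysis" "HOL-Computational_Algebra.Polynomial"
begin

definition tcoeff :: "(complex \<Rightarrow> complex) \<Rightarrow> nat \<Rightarrow> complex" where
  "tcoeff f k = (deriv ^^ k) f 0 / of_nat (fact k)"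

definition hol_disc :: "(complex \<Rightarrow> complex) \<Rightarrow> bool" where
  "hol_disc f \<longleftrightarrow> f holomorphic_on ball 0 1"

definition in_wspace :: "(nat \<Rightarrow> real) \<Rightarrow> (complex \<Rightarrow> complex) \<Rightarrow> bool" where
  "in_wspace w f \<longleftrightarrow> hol_disc f \<and> summable (\<lambda>k. w k * (cmod (tcoeff f k))\<^sup>2)"

definition wnorm :: "(nat \<Rightarrow> real) \<Rightarrow> (complex \<Rightarrow> complex) \<Rightarrow> real" where
  "wnorm w f = sqrt (\<Sum>k. w k * (cmod (tcoeff f k))\<^sup>2)"

definition w_H2 :: "nat \<Rightarrow> real" where "w_H2 k = 1"
definition w_La2 :: "nat \<Rightarrow> real" where "w_La2 k = 1 / (real k + 1)"
definition w_Dir :: "nat \<Rightarrow> real" where "w_Dir k = real k + 1"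

definition Rnr :: "nat \<Rightarrow> real \<Rightarrow> (complex \<Rightarrow> complex) set" where
  "Rnr n r = {f. \<exists>(p::complex poly) (lam::nat \<Rightarrow> complex).
      degree p \<le> n - 1 \<and> (\<forall>j<n. cmod (lam j) \<le> r) \<and>
      f = (\<lambda>z. poly p z / (\<Prod>j<n. 1 - cnj (lam j) * z))}"

definition Cnr :: "nat \<Rightarrow> real \<Rightarrow> (nat \<Rightarrow> real) \<Rightarrow> (nat \<Rightarrow> real) \<Rightarrow> ereal" where
  "Cnr n r wX wY = (SUP f \<in> {f \<in> Rnr n r. \<exists>z \<in> ball 0 1. f z \<noteq> 0}.
      ereal (wnorm wX (deriv f) / wnorm wY f))"

definition blaschke_fac :: "complex \<Rightarrow> complex \<Rightarrow> complex" where
  "blaschke_fac l z = (l - z) / (1 - cnj l * z)"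

definition blaschke :: "complex list \<Rightarrow> complex \<Rightarrow> complex" where
  "blaschke \<sigma> z = prod_list (map (\<lambda>l. blaschke_fac l z) \<sigma>)"

text \<open>g|sigma = f|sigma : f - g \<in> B_sigma Hol(D).\<close>
definition interp_eq :: "complex list \<Rightarrow> (complex \<Rightarrow> complex) \<Rightarrow> (complex \<Rightarrow> complex) \<Rightarrow> bool" where
  "interp_eq \<sigma> g f \<longleftrightarrow> (\<exists>h. h holomorphic_on ball 0 1 \<and>
      (\<forall>z \<in> ball 0 1. f z - g z = blaschke \<sigma> z * h z))"

definition Iint :: "complex list \<Rightarrow> (nat \<Rightarrow> real) \<Rightarrow> (nat \<Rightarrow> real) \<Rightarrow> ereal" where
  "Iint \<sigma> wX wY = (SUP f \<in> {f. in_wspace wX f \<and> wnorm wX f \<le> 1}.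
      (INF g \<in> {g. in_wspace wY g \<and> interp_eq \<sigma> g f}. ereal (wnorm wY g)))"

definition Inr :: "nat \<Rightarrow> real \<Rightarrow> (nat \<Rightarrow> real) \<Rightarrow> (nat \<Rightarrow> real) \<Rightarrow> ereal" where
  "Inr n r wX wY = (SUP \<sigma> \<in> {\<sigma>. length \<sigma> \<le> n \<and> (\<forall>l \<in> set \<sigma>. cmod l \<le> r)}. Iint \<sigma> wX wY)"

end

theory Submission
  imports Defs "HOL-Complex_Analysis.Complex_Analysis"
begin

text \<open>
  Let \<open>S\<close> be the backward shift on \<open>H\<^sup>2\<close>, and for \<open>F \<in> H\<^sup>2\<close>, \<open>|\<lambda>| < 1\<close> put \<open>U = -(1 - \<lambda> S)\<^sup>-\<^sup>1 F\<close> and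
  \<open>G = (S - cnj \<lambda>) U\<close>. Then \<open>F = c / (1 - cnj \<lambda> z) + b\<^sub>\<lambda> G\<close>, and coefficientwise
  \<open>|F\<^sub>k|\<^sup>2 - |G\<^sub>k|\<^sup>2 = (1 - |\<lambda>|\<^sup>2) (|U\<^sub>k|\<^sup>2 - |U\<^sub>k\<^sub>+\<^sub>1|\<^sup>2)\<close>. Summing, the squared \<open>H\<^sup>2\<close> norm drops by
  \<open>(1 - |\<lambda>|\<^sup>2) |U\<^sub>0|\<^sup>2\<close>; summing with weights \<open>k + 1\<close>, the squared Dirichlet norm drops by
  \<open>(1 - |\<lambda>|\<^sup>2) \<parallel>U\<parallel>\<^sup>2 \<le> (1 + r) / (1 - r) \<parallel>F\<parallel>\<^sup>2\<close>. If \<open>F \<in> \<R>\<^sub>n\<^sub>,\<^sub>r\<close> has \<open>\<lambda>\<close> among its parameters, then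
  \<open>G \<in> \<R>\<^sub>n\<^sub>-\<^sub>1\<^sub>,\<^sub>r\<close>, so induction on \<open>n\<close> bounds the squared Dirichlet norm of \<open>F\<close> by
  \<open>n (1 + r) / (1 - r) \<parallel>F\<parallel>\<^sup>2\<close>. This gives \<open>\<C>\<^sub>n\<^sub>,\<^sub>r\<^sup>2 + 1 \<le> n (1 + r) / (1 - r)\<close>, hence the second inequality.
  Iterating the same splitting for arbitrary \<open>F \<in> H\<^sup>2\<close> and dropping the final remainder yields an
  interpolant in \<open>\<R>\<^sub>n\<^sub>,\<^sub>r\<close> of no larger \<open>H\<^sup>2\<close> norm.
\<close>

subsection \<open>Square summable power series\<close>

definition l2 :: "complex fps \<Rightarrow> bool" where
  "l2 F \<longleftrightarrow> summable (\<lambda>k. (cmod (fps_nth F k))\<^sup>2)"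

definition nsq :: "complex fps \<Rightarrow> real" where
  "nsq F = (\<Sum>k. (cmod (fps_nth F k))\<^sup>2)"

lemma nsq_nonneg: "l2 F \<Longrightarrow> 0 \<le> nsq F"
  by (simp add: l2_def nsq_def suminf_nonneg)

text \<open>Reduces square summability to uniformly bounded finite sections, where Minkowski's
  inequality for \<open>L2_set\<close> is available.\<close>

lemma l2_I:
  assumes "\<And>N. L2_set (\<lambda>k. cmod (fps_nth F k)) {..<N} \<le> B"
  shows "l2 F"
  unfolding l2_def
proof (rule summableI_nonneg_bounded)
  fix N
  have "(L2_set (\<lambda>k. cmod (fps_nth F k)) {..<N})\<^sup>2 \<le> B\<^sup>2"
    by (intro power_mono assms) simp
  then show "(\<Sum>k<N. (cmod (fps_nth F k))\<^sup>2) \<le> B\<^sup>2"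
    by (simp add: L2_set_def sum_nonneg)
qed simp

lemma l2_L2_set_le:
  assumes "l2 F" "finite A"
  shows "L2_set (\<lambda>k. cmod (fps_nth F k)) A \<le> sqrt (nsq F)"
  unfolding L2_set_def nsq_def
  using assms by (auto simp: l2_def intro!: sum_le_suminf)

lemma l2_tendsto_0:
  assumes "l2 F"
  shows "(\<lambda>k. cmod (fps_nth F k)) \<longlonglongrightarrow> 0"
proof -
  have "(\<lambda>k. (cmod (fps_nth F k))\<^sup>2) \<longlonglongrightarrow> 0"
    using assms unfolding l2_def by (rule summable_LIMSEQ_zero)
  then have "(\<lambda>k. sqrt ((cmod (fps_nth F k))\<^sup>2)) \<longlonglongrightarrow> sqrt 0"
    by (rule tendsto_real_sqrt)
  then show ?thesis by simp
qed

lemma l2_add: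
  assumes "l2 F" "l2 G"
  shows "l2 (F + G)"
proof (rule l2_I)
  fix N
  have "L2_set (\<lambda>k. cmod (fps_nth (F + G) k)) {..<N}
      \<le> L2_set (\<lambda>k. cmod (fps_nth F k) + cmod (fps_nth G k)) {..<N}"
    by (intro L2_set_mono) (auto simp: norm_triangle_ineq)
  also have "\<dots> \<le> L2_set (\<lambda>k. cmod (fps_nth F k)) {..<N} + L2_set (\<lambda>k. cmod (fps_nth G k)) {..<N}"
    by (rule L2_set_triangle_ineq)
  also have "\<dots> \<le> sqrt (nsq F) + sqrt (nsq G)"
    by (intro add_mono l2_L2_set_le assms) auto
  finally show "L2_set (\<lambda>k. cmod (fps_nth (F + G) k)) {..<N} \<le> sqrt (nsq F) + sqrt (nsq G)" .
qed

lemma l2_cmult: "l2 F \<Longrightarrow> l2 (fps_const c * F)"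
  by (simp add: l2_def norm_mult power_mult_distrib summable_mult)

lemma l2_shift: "l2 F \<Longrightarrow> l2 (fps_shift n F)"
  unfolding l2_def fps_shift_nth by (rule summable_ignore_initial_segment)

lemma l2_mult_X: "l2 F \<Longrightarrow> l2 (fps_X * F)"
  unfolding l2_def by (subst summable_Suc_iff [symmetric]) simp

lemma l2_diff: "l2 F \<Longrightarrow> l2 G \<Longrightarrow> l2 (F - G)"
  using l2_add [OF _ l2_cmult [of G "-1"], of F]
  by (simp only: diff_conv_add_uminus fps_const_neg [symmetric] fps_const_1_eq_1 mult_minus1)

lemma l2_mult_poly:
  assumes "l2 F"
  shows "l2 (F * fps_of_poly p)"
proof (induction p)
  case 0
  then show ?case by (simp add: l2_def)
next
  case (pCons c p)
  have "F * fps_of_poly (pCons c p) = fps_const c * F + fps_X * (F * fps_of_poly p)"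
    by (simp add: fps_of_poly_pCons algebra_simps)
  then show ?case
    using pCons.IH assms by (simp add: l2_add l2_cmult l2_mult_X)
qed

text \<open>Square summable coefficients tend to 0, hence are bounded, so a geometric series
  dominates inside the unit disc.\<close>

lemma l2_conv_radius:
  assumes "l2 F"
  shows "fps_conv_radius F \<ge> 1"
  unfolding fps_conv_radius_def
proof (rule conv_radius_geI_ex')
  fix r :: real
  assume r: "0 < r" "ereal r < 1"
  then have r1: "r < 1" by (simp add: one_ereal_def)
  have "Bseq (\<lambda>k. cmod (fps_nth F k))"
    by (rule convergent_imp_Bseq [OF convergentI [OF l2_tendsto_0 [OF assms]]])
  then obtain K where K: "\<And>k. cmod (fps_nth F k) \<le> K"
    by (auto simp: Bseq_def)
  have "summable (\<lambda>k. K * r ^ k)"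
    using r r1 by (intro summable_mult summable_geometric) simp
  then show "summable (\<lambda>k. fps_nth F k * of_real r ^ k)"
    by (rule summable_comparison_test')
      (use K r in \<open>auto simp: norm_mult norm_power intro!: mult_right_mono\<close>)
qed

section \<open>Solving linear equations in the backward shift\<close>

text \<open>The section of length \<open>Suc N\<close> is at most \<open>|U 0|\<close> plus
  \<open>|l|\<close> times the section of length \<open>N\<close> plus the norm of \<open>F\<close>;
  as \<open>|l| < 1\<close>, the middle term is absorbed. Applied with \<open>cnj l\<close>, this
  recovers \<open>U\<close> from \<open>G\<close> and the entry \<open>U 0\<close>.\<close>

lemma resolvent_recursion_l2:
  assumes F: "l2 F" and l: "cmod l < 1"
    and rec: "\<And>k. fps_nth U (Suc k) = l * fps_nth U k + fps_nth F k"
  shows "l2 U"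
proof (rule l2_I)
  fix N
  let ?U = "\<lambda>k. cmod (fps_nth U k)" and ?F = "\<lambda>k. cmod (fps_nth F k)"
  let ?B = "(?U 0 + sqrt (nsq F)) / (1 - cmod l)"
  have "L2_set ?U {..<Suc N} \<le> ?U 0 + cmod l * L2_set ?U {..<N} + sqrt (nsq F)" for N
  proof -
    have "L2_set ?U {..<Suc N} = sqrt ((?U 0)\<^sup>2 + (L2_set (\<lambda>k. ?U (Suc k)) {..<N})\<^sup>2)"
      by (simp add: L2_set_def sum.lessThan_Suc_shift sum_nonneg del: sum.lessThan_Suc)
    also have "\<dots> \<le> ?U 0 + L2_set (\<lambda>k. ?U (Suc k)) {..<N}"
      by (rule real_le_lsqrt) (auto simp: power2_sum)
    also have "L2_set (\<lambda>k. ?U (Suc k)) {..<N} \<le> L2_set (\<lambda>k. cmod l * ?U k + ?F k) {..<N}"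
      by (intro L2_set_mono) (auto simp: rec norm_mult [symmetric] norm_triangle_ineq)
    also have "\<dots> \<le> L2_set (\<lambda>k. cmod l * ?U k) {..<N} + L2_set ?F {..<N}"
      by (rule L2_set_triangle_ineq)
    also have "L2_set (\<lambda>k. cmod l * ?U k) {..<N} = cmod l * L2_set ?U {..<N}"
      by (rule L2_set_right_distrib [symmetric]) simp
    also have "L2_set ?F {..<N} \<le> sqrt (nsq F)"
      by (rule l2_L2_set_le [OF F]) simp
    finally show ?thesis by simp
  qed
  moreover have "L2_set ?U {..<N} \<le> L2_set ?U {..<Suc N}"
    by (simp add: L2_set_def)
  ultimately have "L2_set ?U {..<N} \<le> ?U 0 + cmod l * L2_set ?U {..<N} + sqrt (nsq F)"
    by (meson order_trans)
  then show "L2_set ?U {..<N} \<le> ?B"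
    using l by (simp add: field_simps)
qed

text \<open>Since \<open>U = l S U - F\<close> and the shift is a contraction, the norm of
  \<open>U\<close> is at most \<open>|l|\<close> times itself plus the norm of \<open>F\<close>. The
  estimate is made on sections and passed to the limit.\<close>

lemma resolvent_l2_bound:
  assumes F: "l2 F" and U: "l2 U" and l: "cmod l < 1"
    and rec: "\<And>k. fps_nth F k = l * fps_nth U (Suc k) - fps_nth U k"
  shows "(1 - cmod l)\<^sup>2 * nsq U \<le> nsq F"
proof -
  have le: "(1 - cmod l) * sqrt (nsq U) \<le> sqrt (nsq F)"
  proof -
    let ?U = "\<lambda>k. cmod (fps_nth U k)" and ?F = "\<lambda>k. cmod (fps_nth F k)"
    have "L2_set ?U {..<N} \<le> L2_set (\<lambda>k. cmod l * ?U (Suc k) + ?F k) {..<N}" for N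
    proof (intro L2_set_mono)
      fix k
      have "fps_nth U k = l * fps_nth U (Suc k) - fps_nth F k" by (simp add: rec)
      then show "?U k \<le> cmod l * ?U (Suc k) + ?F k"
        by (metis norm_mult norm_triangle_ineq4)
    qed auto
    also have "\<dots> N \<le> L2_set (\<lambda>k. cmod l * ?U (Suc k)) {..<N} + L2_set ?F {..<N}" for N
      by (rule L2_set_triangle_ineq)
    also have "\<dots> N \<le> cmod l * sqrt (nsq U) + sqrt (nsq F)" for N
    proof (intro add_mono l2_L2_set_le F)
      have "L2_set (\<lambda>k. ?U (Suc k)) {..<N} = sqrt (\<Sum>k\<in>Suc ` {..<N}. (?U k)\<^sup>2)"
        by (simp add: L2_set_def sum.reindex)
      also have "\<dots> \<le> sqrt (nsq U)"
        using l2_L2_set_le [OF U, of "Suc ` {..<N}"] by (simp add: L2_set_def)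
      finally show "L2_set (\<lambda>k. cmod l * ?U (Suc k)) {..<N} \<le> cmod l * sqrt (nsq U)"
        by (simp add: L2_set_right_distrib [symmetric] mult_left_mono)
    qed auto
    finally have "\<And>N. L2_set ?U {..<N} \<le> cmod l * sqrt (nsq U) + sqrt (nsq F)" .
    moreover have "(\<lambda>N. L2_set ?U {..<N}) \<longlonglongrightarrow> sqrt (nsq U)"
      unfolding L2_set_def nsq_def using U
      by (intro tendsto_real_sqrt summable_LIMSEQ) (simp add: l2_def)
    ultimately have "sqrt (nsq U) \<le> cmod l * sqrt (nsq U) + sqrt (nsq F)"
      by (intro LIMSEQ_le_const2) auto
    then show ?thesis by (simp add: algebra_simps)
  qed
  then have "((1 - cmod l) * sqrt (nsq U))\<^sup>2 \<le> (sqrt (nsq F))\<^sup>2"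
    using l nsq_nonneg [OF U] by (intro power_mono) auto
  then show ?thesis
    using nsq_nonneg [OF U] nsq_nonneg [OF F] by (simp add: power_mult_distrib)
qed

lemma resolvent_ex:
  assumes F: "l2 F" and l: "cmod l < 1"
  obtains U where "l2 U" "\<And>k. fps_nth F k = l * fps_nth U (Suc k) - fps_nth U k"
proof -
  let ?F = "\<lambda>k. cmod (fps_nth F k)"
  have Bd: "?F k \<le> sqrt (nsq F)" for k
    using l2_L2_set_le [OF F, of "{k}"] by (simp add: L2_set_def)
  have geo: "summable (\<lambda>m. cmod l ^ m * sqrt (nsq F))"
    using l by (intro summable_mult2 summable_geometric) simp
  have sm: "summable (\<lambda>m. norm (l ^ m * fps_nth F (k + m)))" for k
    by (rule summable_comparison_test' [OF geo])
      (use Bd in \<open>auto simp: norm_mult norm_power intro!: mult_left_mono\<close>)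
  \<comment> \<open>Neumann series for \<open>-(1 - l S)\<close> inverse, entry by entry; it
    converges because the entries of \<open>F\<close> are bounded.\<close>
  define U where "U = Abs_fps (\<lambda>k. - (\<Sum>m. l ^ m * fps_nth F (k + m)))"
  have rec: "fps_nth F k = l * fps_nth U (Suc k) - fps_nth U k" for k
  proof -
    have "(\<Sum>m. l ^ m * fps_nth F (k + m)) = l ^ 0 * fps_nth F (k + 0) + (\<Sum>m. l ^ Suc m * fps_nth F (k + Suc m))"
      using suminf_split_head [OF summable_norm_cancel [OF sm [of k]]] by simp
    also have "(\<Sum>m. l ^ Suc m * fps_nth F (k + Suc m)) = l * (\<Sum>m. l ^ m * fps_nth F (Suc k + m))"
      using suminf_mult [OF summable_norm_cancel [OF sm [of "Suc k"]], of l] by (simp add: mult.assoc)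
    finally show ?thesis by (simp add: U_def)
  qed
  \<comment> \<open>A uniform bound for the entries of \<open>U\<close>. Shifting the section of
    length \<open>N\<close> brings in the entry \<open>U N\<close>, and \<open>M\<close> controls it
    before \<open>U\<close> is known to be square summable.\<close>
  define M where "M = (\<Sum>m. cmod l ^ m * sqrt (nsq F))"
  have M: "cmod (fps_nth U k) \<le> M" for k
  proof -
    have "cmod (fps_nth U k) \<le> (\<Sum>m. norm (l ^ m * fps_nth F (k + m)))"
      using summable_norm [OF sm [of k]] by (simp add: U_def)
    also have "\<dots> \<le> M"
      unfolding M_def
      by (rule suminf_le [OF _ sm geo]) (auto simp: norm_mult norm_power intro!: mult_left_mono Bd)
    finally show ?thesis .
  qed
  have "l2 U"
  proof (rule l2_I)
    fix N
    let ?U = "\<lambda>k. cmod (fps_nth U k)"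
    let ?B = "(cmod l * M + sqrt (nsq F)) / (1 - cmod l)"
    have "L2_set ?U {..<N} \<le> L2_set (\<lambda>k. cmod l * ?U (Suc k) + ?F k) {..<N}"
    proof (intro L2_set_mono)
      fix k
      have "fps_nth U k = l * fps_nth U (Suc k) - fps_nth F k" by (simp add: rec)
      then show "?U k \<le> cmod l * ?U (Suc k) + ?F k"
        by (metis norm_mult norm_triangle_ineq4)
    qed auto
    also have "\<dots> \<le> L2_set (\<lambda>k. cmod l * ?U (Suc k)) {..<N} + L2_set ?F {..<N}"
      by (rule L2_set_triangle_ineq)
    also have "\<dots> \<le> cmod l * (L2_set ?U {..<N} + M) + sqrt (nsq F)"
    proof (intro add_mono l2_L2_set_le F)
      have M0: "M \<ge> 0" using M [of 0] norm_ge_zero order_trans by blast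
      have "(\<Sum>k<N. (?U (Suc k))\<^sup>2) \<le> (\<Sum>k<Suc N. (?U k)\<^sup>2)"
        by (subst sum.lessThan_Suc_shift) simp
      also have "\<dots> = (L2_set ?U {..<N})\<^sup>2 + (?U N)\<^sup>2"
        by (simp add: L2_set_def sum_nonneg)
      also have "\<dots> \<le> (L2_set ?U {..<N})\<^sup>2 + M\<^sup>2"
        by (intro add_left_mono power_mono M) simp
      also have "\<dots> \<le> (L2_set ?U {..<N} + M)\<^sup>2"
        using M0 by (simp add: power2_sum)
      finally have "L2_set (\<lambda>k. ?U (Suc k)) {..<N} \<le> L2_set ?U {..<N} + M"
        using M0 by (subst L2_set_def) (intro real_le_lsqrt, auto)
      then show "L2_set (\<lambda>k. cmod l * ?U (Suc k)) {..<N} \<le> cmod l * (L2_set ?U {..<N} + M)"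
        by (simp add: L2_set_right_distrib [symmetric] mult_left_mono)
    qed auto
    finally show "L2_set ?U {..<N} \<le> ?B"
      using l by (simp add: field_simps)
  qed
  with rec that show ?thesis by blast
qed

subsection \<open>Splitting off a Blaschke factor\<close>

text \<open>Both squares have the same cross term, minus twice the real part of
  \<open>l * x * cnj y\<close>, so only the pure squares survive.\<close>

lemma cmod_blaschke_diff:
  "(cmod (l * x - y))\<^sup>2 - (cmod (x - cnj l * y))\<^sup>2 = (1 - (cmod l)\<^sup>2) * ((cmod y)\<^sup>2 - (cmod x)\<^sup>2)"
  unfolding cmod_power2 by (simp add: power2_eq_square algebra_simps)

text \<open>A relation parametrised by \<open>U\<close>, because it is used in both directions: from
  \<open>F\<close> down to \<open>G\<close>, and from \<open>G\<close> with a prescribed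
  \<open>U 0\<close> back up to \<open>F\<close>.\<close>

definition blaschke_split :: "complex \<Rightarrow> complex fps \<Rightarrow> complex fps \<Rightarrow> complex fps \<Rightarrow> bool" where
  "blaschke_split l U F G \<longleftrightarrow> (\<forall>k. fps_nth F k = l * fps_nth U (Suc k) - fps_nth U k) \<and>
     (\<forall>k. fps_nth G k = fps_nth U (Suc k) - cnj l * fps_nth U k)"

lemma blaschke_split_l2:
  assumes "l2 U" "blaschke_split l U F G"
  shows "l2 F" "l2 G"
proof -
  have "F = fps_const l * fps_shift 1 U - U" "G = fps_shift 1 U - fps_const (cnj l) * U"
    using assms(2) by (auto simp: blaschke_split_def fps_eq_iff)
  then show "l2 F" "l2 G"
    using assms(1) by (auto intro!: l2_diff l2_shift l2_cmult)
qed

text \<open>Written through \<open>U\<close>, using \<open>z S U = U - U 0\<close>, both products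
  agree up to a multiple of the constant \<open>U 0\<close>.\<close>

lemma blaschke_split_identity:
  assumes "blaschke_split l U F G"
  shows "F * fps_of_poly [:1, - cnj l:] =
    fps_const (- (1 - (cmod l)\<^sup>2) * fps_nth U 0) + fps_of_poly [:l, -1:] * G"
proof (rule fps_ext)
  fix k
  have l: "complex_of_real ((cmod l)\<^sup>2) = l * cnj l"
    using complex_norm_square by blast
  have F: "\<And>k. fps_nth F k = l * fps_nth U (Suc k) - fps_nth U k"
    and G: "\<And>k. fps_nth G k = fps_nth U (Suc k) - cnj l * fps_nth U k"
    using assms by (auto simp: blaschke_split_def)
  have 1: "fps_nth (F * fps_of_poly [:1, - cnj l:]) k = fps_nth F k - (if k = 0 then 0 else cnj l * fps_nth F (k - 1))"
    by (subst mult.commute) (simp add: fps_of_poly_pCons distrib_right mult.assoc)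
  have 2: "fps_nth (fps_of_poly [:l, -1:] * G) k = l * fps_nth G k - (if k = 0 then 0 else fps_nth G (k - 1))"
    by (simp add: fps_of_poly_pCons distrib_right mult.assoc)
  show "fps_nth (F * fps_of_poly [:1, - cnj l:]) k =
    fps_nth (fps_const (- (1 - (cmod l)\<^sup>2) * fps_nth U 0) + fps_of_poly [:l, -1:] * G) k"
    unfolding fps_add_nth 1 2 F G using l by (cases k) (simp_all add: algebra_simps)
qed

lemma blaschke_split_coeff_diff:
  assumes "blaschke_split l U F G"
  shows "(cmod (fps_nth F k))\<^sup>2 - (cmod (fps_nth G k))\<^sup>2 =
    (1 - (cmod l)\<^sup>2) * ((cmod (fps_nth U k))\<^sup>2 - (cmod (fps_nth U (Suc k)))\<^sup>2)"
  using assms cmod_blaschke_diff by (simp add: blaschke_split_def)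

text \<open>The coefficientwise differences telescope, and the entries of \<open>U\<close> tend to
  0.\<close>

lemma blaschke_split_nsq:
  assumes U: "l2 U" and b: "blaschke_split l U F G"
  shows "nsq F - nsq G = (1 - (cmod l)\<^sup>2) * (cmod (fps_nth U 0))\<^sup>2"
proof -
  have "(\<lambda>k. (cmod (fps_nth U (Suc k)))\<^sup>2 - (cmod (fps_nth U k))\<^sup>2) sums (0 - (cmod (fps_nth U 0))\<^sup>2)"
    using U unfolding l2_def by (intro telescope_sums summable_LIMSEQ_zero)
  then have "(\<lambda>k. (1 - (cmod l)\<^sup>2) * - ((cmod (fps_nth U (Suc k)))\<^sup>2 - (cmod (fps_nth U k))\<^sup>2))
      sums ((1 - (cmod l)\<^sup>2) * - (0 - (cmod (fps_nth U 0))\<^sup>2))"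
    by (intro sums_mult sums_minus)
  then have "(\<lambda>k. (cmod (fps_nth F k))\<^sup>2 - (cmod (fps_nth G k))\<^sup>2)
      sums ((1 - (cmod l)\<^sup>2) * (cmod (fps_nth U 0))\<^sup>2)"
    by (simp add: blaschke_split_coeff_diff [OF b])
  moreover have "(\<lambda>k. (cmod (fps_nth F k))\<^sup>2 - (cmod (fps_nth G k))\<^sup>2) sums (nsq F - nsq G)"
    unfolding nsq_def using blaschke_split_l2 [OF U b]
    by (intro sums_diff summable_sums) (auto simp: l2_def)
  ultimately show ?thesis by (rule sums_unique2 [symmetric])
qed

lemma blaschke_split_dirichlet:
  assumes U: "l2 U" and b: "blaschke_split l U F G" and l: "cmod l \<le> r" and r: "r < 1"
  shows "(\<Sum>k<N. (real k + 1) * (cmod (fps_nth F k))\<^sup>2)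
    \<le> (\<Sum>k<N. (real k + 1) * (cmod (fps_nth G k))\<^sup>2) + (1 + r) / (1 - r) * nsq F"
proof -
  let ?u = "\<lambda>k. (cmod (fps_nth U k))\<^sup>2"
  have "(\<Sum>k<N. (real k + 1) * (cmod (fps_nth F k))\<^sup>2) - (\<Sum>k<N. (real k + 1) * (cmod (fps_nth G k))\<^sup>2)
     = (1 - (cmod l)\<^sup>2) * (\<Sum>k<N. (real k + 1) * (?u k - ?u (Suc k)))"
    by (simp add: sum_subtractf [symmetric] right_diff_distrib [symmetric] blaschke_split_coeff_diff [OF b]
        sum_distrib_left mult.left_commute)
  also have "(\<Sum>k<N. (real k + 1) * (?u k - ?u (Suc k))) = (\<Sum>k<N. ?u k) - real N * ?u N"
    by (induction N) (simp_all add: algebra_simps)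
  also have "(1 - (cmod l)\<^sup>2) * \<dots> \<le> (1 - (cmod l)\<^sup>2) * nsq U"
  proof (rule mult_left_mono)
    have "(\<Sum>k<N. ?u k) \<le> nsq U"
      unfolding nsq_def using U by (intro sum_le_suminf) (auto simp: l2_def)
    moreover have "0 \<le> real N * ?u N" by simp
    ultimately show "(\<Sum>k<N. ?u k) - real N * ?u N \<le> nsq U" by linarith
    show "0 \<le> 1 - (cmod l)\<^sup>2"
      using l r by (simp add: abs_square_le_1)
  qed
  also have "(1 - (cmod l)\<^sup>2) * nsq U \<le> (1 + r) / (1 - r) * nsq F"
  proof -
    have l1: "cmod l < 1" using l r by simp
    have r0: "0 \<le> r" using l norm_ge_zero order_trans by blast
    have nF: "(1 - cmod l)\<^sup>2 * nsq U \<le> nsq F"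
      using b by (intro resolvent_l2_bound blaschke_split_l2 [OF U b] U l1) (auto simp: blaschke_split_def)
    \<comment> \<open>Rewritten to expose the factor from \<open>resolvent_l2_bound\<close>; the
      remaining quotient increases with \<open>|l|\<close>, which gives the constant in
      \<open>r\<close>.\<close>
    have "(1 - (cmod l)\<^sup>2) * nsq U = (1 + cmod l) / (1 - cmod l) * ((1 - cmod l)\<^sup>2 * nsq U)"
      using l1 by (simp add: field_simps power2_eq_square)
    also have "\<dots> \<le> (1 + cmod l) / (1 - cmod l) * nsq F"
      using l1 nF by (intro mult_left_mono) auto
    also have "\<dots> \<le> (1 + r) / (1 - r) * nsq F"
      using l r l1 r0 nsq_nonneg [OF blaschke_split_l2(1) [OF U b]]
      by (intro mult_right_mono frac_le) auto
    finally show ?thesis .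
  qed
  finally show ?thesis by simp
qed

section \<open>Model spaces: the Dirichlet norm estimate and interpolation\<close>

text \<open>With \<open>num_poly\<close> this presents \<open>blaschke\<close> as a quotient of
  polynomials, so that interpolation becomes an identity of formal power series.\<close>

definition den_poly :: "complex list \<Rightarrow> complex poly" where
  "den_poly \<sigma> = prod_list (map (\<lambda>l. [:1, - cnj l:]) \<sigma>)"

definition num_poly :: "complex list \<Rightarrow> complex poly" where
  "num_poly \<sigma> = prod_list (map (\<lambda>l. [:l, -1:]) \<sigma>)"

lemma den_poly_simps [simp]: "den_poly [] = 1" "den_poly (l # \<sigma>) = [:1, - cnj l:] * den_poly \<sigma>"
  and num_poly_simps [simp]: "num_poly [] = 1" "num_poly (l # \<sigma>) = [:l, -1:] * num_poly \<sigma>"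
  by (simp_all add: den_poly_def num_poly_def)

lemma degree_den_poly: "degree (den_poly \<sigma>) \<le> length \<sigma>"
proof (induction \<sigma>)
  case (Cons l \<sigma>)
  have "degree (den_poly (l # \<sigma>)) \<le> degree [:1, - cnj l:] + degree (den_poly \<sigma>)"
    unfolding den_poly_simps by (rule degree_mult_le)
  also have "\<dots> \<le> 1 + length \<sigma>" using Cons by (intro add_mono) auto
  finally show ?case by simp
qed simp

text \<open>Let \<open>R\<^sub>k\<close> be the coefficients of \<open>G\<close> times the shorter denominator. Comparing coefficients in
  \<open>blaschke_split_identity\<close> beyond the degree of \<open>P\<close> gives \<open>R\<^sub>k = \<lambda> R\<^sub>k\<^sub>+\<^sub>1\<close>; since \<open>R\<^sub>k\<close> tends to 0, all these
  coefficients vanish.\<close>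
lemma blaschke_split_model_space:
  assumes U: "l2 U" and b: "blaschke_split l U F G" and l: "cmod l < 1"
    and P: "F * fps_of_poly (den_poly (l # \<sigma>)) = fps_of_poly P" "\<And>k. k \<ge> Suc (length \<sigma>) \<Longrightarrow> coeff P k = 0"
  obtains Q where "G * fps_of_poly (den_poly \<sigma>) = fps_of_poly Q" "\<And>k. k \<ge> length \<sigma> \<Longrightarrow> coeff Q k = 0"
proof -
  define R where "R = G * fps_of_poly (den_poly \<sigma>)"
  define c where "c = - (1 - (cmod l)\<^sup>2) * fps_nth U 0"
  have "fps_of_poly P = (F * fps_of_poly [:1, - cnj l:]) * fps_of_poly (den_poly \<sigma>)"
    by (simp add: P(1) [symmetric] fps_of_poly_mult mult_ac)
  also have "\<dots> = fps_const c * fps_of_poly (den_poly \<sigma>) + (fps_const l * R - fps_X * R)"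
    unfolding blaschke_split_identity [OF b] R_def c_def
    by (simp add: fps_of_poly_pCons algebra_simps fps_const_neg [symmetric] del: fps_const_neg)
  finally have eq: "fps_of_poly P = fps_const c * fps_of_poly (den_poly \<sigma>) + (fps_const l * R - fps_X * R)" .
  have rec: "fps_nth R k = l * fps_nth R (Suc k)" if "k \<ge> length \<sigma>" for k
  proof -
    have "coeff (den_poly \<sigma>) (Suc k) = 0"
      using degree_den_poly [of \<sigma>] that by (intro coeff_eq_0) linarith
    moreover have "coeff P (Suc k) = 0" using P(2) that by simp
    ultimately show ?thesis
      using arg_cong [OF eq, of "\<lambda>F. fps_nth F (Suc k)"] by simp
  qed
  have "l2 R" unfolding R_def by (intro l2_mult_poly blaschke_split_l2 [OF U b])
  have R0: "fps_nth R k = 0" if k: "k \<ge> length \<sigma>" for k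
  proof -
    have it: "fps_nth R k = l ^ m * fps_nth R (k + m)" for m
    proof (induction m)
      case (Suc m)
      have "fps_nth R (k + m) = l * fps_nth R (k + Suc m)" using rec [of "k + m"] k by simp
      then show ?case using Suc by simp
    qed simp
    have "cmod (fps_nth R k) \<le> cmod (fps_nth R (k + m))" for m
    proof -
      have "cmod (fps_nth R k) = cmod l ^ m * cmod (fps_nth R (k + m))"
        by (subst it [of m]) (simp add: norm_mult norm_power)
      also have "\<dots> \<le> 1 * cmod (fps_nth R (k + m))"
        using l by (intro mult_right_mono power_le_one) auto
      finally show ?thesis by simp
    qed
    moreover have "(\<lambda>m. cmod (fps_nth R (k + m))) \<longlonglongrightarrow> 0"
      using LIMSEQ_ignore_initial_segment [OF l2_tendsto_0 [OF \<open>l2 R\<close>], of k] by (simp add: add.commute)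
    ultimately have "cmod (fps_nth R k) \<le> 0"
      by (intro LIMSEQ_le_const) auto
    then show ?thesis by simp
  qed
  define Q where "Q = poly_of_list (map (fps_nth R) [0..<length \<sigma>])"
  have cQ: "coeff Q k = fps_nth R k" for k
    using R0 by (auto simp: Q_def nth_default_def)
  show ?thesis
    using that [of Q] R0 by (simp add: R_def [symmetric] cQ fps_eq_iff)
qed

text \<open>Each factor costs \<open>(1 + r) / (1 - r)\<close> times the squared norm of the current
  function, and that norm never grows. Partial sums are bounded, so summability of the Dirichlet
  series comes out as a consequence. Vanishing of coefficients replaces a degree bound so that an
  empty list forces \<open>F = 0\<close> instead of admitting constants.\<close>

lemma model_space_dirichlet:
  assumes r: "r < 1" and "\<forall>l\<in>set \<sigma>. cmod l \<le> r" and "l2 F"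
    and "F * fps_of_poly (den_poly \<sigma>) = fps_of_poly P" "\<And>k. k \<ge> length \<sigma> \<Longrightarrow> coeff P k = 0"
  shows "(\<Sum>k<N. (real k + 1) * (cmod (fps_nth F k))\<^sup>2) \<le> real (length \<sigma>) * ((1 + r) / (1 - r)) * nsq F"
  using assms(2-)
proof (induction \<sigma> arbitrary: F P)
  case Nil
  then have "F = 0" by (simp add: fps_eq_iff)
  then show ?case by simp
next
  case (Cons l \<sigma>)
  have l: "cmod l \<le> r" "cmod l < 1" using Cons.prems r by auto
  obtain U where U: "l2 U" "\<And>k. fps_nth F k = l * fps_nth U (Suc k) - fps_nth U k"
    using resolvent_ex [OF Cons.prems(2) l(2)] by blast
  define G where "G = Abs_fps (\<lambda>k. fps_nth U (Suc k) - cnj l * fps_nth U k)"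
  have b: "blaschke_split l U F G" by (simp add: blaschke_split_def U G_def)
  obtain Q where Q: "G * fps_of_poly (den_poly \<sigma>) = fps_of_poly Q" "\<And>k. k \<ge> length \<sigma> \<Longrightarrow> coeff Q k = 0"
    using blaschke_split_model_space [OF U(1) b l(2) Cons.prems(3)] Cons.prems(4) by auto
  let ?\<alpha> = "(1 + r) / (1 - r)"
  have "(\<Sum>k<N. (real k + 1) * (cmod (fps_nth F k))\<^sup>2)
    \<le> (\<Sum>k<N. (real k + 1) * (cmod (fps_nth G k))\<^sup>2) + ?\<alpha> * nsq F"
    by (rule blaschke_split_dirichlet [OF U(1) b l(1) r])
  also have "(\<Sum>k<N. (real k + 1) * (cmod (fps_nth G k))\<^sup>2) \<le> real (length \<sigma>) * ?\<alpha> * nsq G"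
    using Cons.prems by (intro Cons.IH [OF _ _ Q] blaschke_split_l2 [OF U(1) b]) auto
  also have "\<dots> \<le> real (length \<sigma>) * ?\<alpha> * nsq F"
  proof (rule mult_left_mono)
    have "0 \<le> (1 - (cmod l)\<^sup>2) * (cmod (fps_nth U 0))\<^sup>2"
      using l by (simp add: abs_square_le_1)
    then show "nsq G \<le> nsq F" using blaschke_split_nsq [OF U(1) b] by linarith
    have "0 \<le> r" using l norm_ge_zero order_trans by blast
    then show "0 \<le> real (length \<sigma>) * ?\<alpha>" using r by simp
  qed
  also have "real (length \<sigma>) * ?\<alpha> * nsq F + ?\<alpha> * nsq F = real (length (l # \<sigma>)) * ?\<alpha> * nsq F"
    by (simp only: length_Cons of_nat_Suc distrib_right mult_1_left add.commute)
  finally show ?case by simp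
qed

text \<open>Split a factor off \<open>F\<close>, interpolate the quotient \<open>F1\<close> by
  \<open>G1\<close>, and lift \<open>G1\<close> to \<open>G\<close> with the same constant term, so
  that \<open>F - G\<close> is the factor times \<open>F1 - G1\<close>.\<close>

lemma model_space_interpolant:
  assumes "\<forall>l\<in>set \<sigma>. cmod l < 1" and "l2 F"
  obtains G D P where "l2 D" "nsq G \<le> nsq F"
    "G * fps_of_poly (den_poly \<sigma>) = fps_of_poly P" "\<forall>k \<ge> length \<sigma>. coeff P k = 0"
    "(F - G) * fps_of_poly (den_poly \<sigma>) = fps_of_poly (num_poly \<sigma>) * D"
proof -
  have "\<exists>G D P. l2 D \<and> nsq G \<le> nsq F \<and>
    G * fps_of_poly (den_poly \<sigma>) = fps_of_poly P \<and> (\<forall>k \<ge> length \<sigma>. coeff P k = 0) \<and>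
    (F - G) * fps_of_poly (den_poly \<sigma>) = fps_of_poly (num_poly \<sigma>) * D \<and> l2 G"
    using assms
  proof (induction \<sigma> arbitrary: F)
    case Nil
    \<comment> \<open>Without nodes the interpolant is 0 and the whole of \<open>F\<close> is the
      remainder \<open>D\<close>.\<close>
    show ?case
      by (rule exI [of _ 0], rule exI [of _ F], rule exI [of _ 0])
        (use Nil nsq_nonneg [of F] in \<open>auto simp: l2_def nsq_def\<close>)
  next
    case (Cons l \<sigma>)
    have l: "cmod l < 1" using Cons.prems by auto
    obtain U where U: "l2 U" "\<And>k. fps_nth F k = l * fps_nth U (Suc k) - fps_nth U k"
      using resolvent_ex [OF Cons.prems(2) l] by blast
    define F1 where "F1 = Abs_fps (\<lambda>k. fps_nth U (Suc k) - cnj l * fps_nth U k)"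
    have b: "blaschke_split l U F F1" by (simp add: blaschke_split_def U F1_def)
    obtain G1 D P1 where IH: "l2 D" "nsq G1 \<le> nsq F1" "l2 G1"
      "G1 * fps_of_poly (den_poly \<sigma>) = fps_of_poly P1" "\<And>k. k \<ge> length \<sigma> \<Longrightarrow> coeff P1 k = 0"
      "(F1 - G1) * fps_of_poly (den_poly \<sigma>) = fps_of_poly (num_poly \<sigma>) * D"
      using Cons.IH [of F1] blaschke_split_l2 [OF U(1) b] Cons.prems by auto
    \<comment> \<open>Solves \<open>(S - cnj l) V = G1\<close>. The free initial entry is taken from
      \<open>U\<close>, which makes the constants in the two splittings equal.\<close>
    define V where "V = Abs_fps (rec_nat (fps_nth U 0) (\<lambda>k v. cnj l * v + fps_nth G1 k))"
    have V0: "fps_nth V 0 = fps_nth U 0"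
      and V: "\<And>k. fps_nth V (Suc k) = cnj l * fps_nth V k + fps_nth G1 k"
      by (simp_all add: V_def)
    have V2: "l2 V"
      by (rule resolvent_recursion_l2 [OF IH(3) _ V]) (use l in simp)
    define G where "G = Abs_fps (\<lambda>k. l * fps_nth V (Suc k) - fps_nth V k)"
    have c: "blaschke_split l V G G1" by (simp add: blaschke_split_def G_def V)
    define a where "a = - (1 - (cmod l)\<^sup>2) * fps_nth U 0"
    have F_eq: "F * fps_of_poly [:1, - cnj l:] = fps_const a + fps_of_poly [:l, -1:] * F1"
      and G_eq: "G * fps_of_poly [:1, - cnj l:] = fps_const a + fps_of_poly [:l, -1:] * G1"
      using blaschke_split_identity [OF b] blaschke_split_identity [OF c] by (simp_all only: a_def V0)
    define P where "P = smult a (den_poly \<sigma>) + [:l, -1:] * P1"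
    \<comment> \<open>Both splittings lower the squared norm by the same amount, so the inequality
      for \<open>G1\<close> and \<open>F1\<close> transfers.\<close>
    have "nsq G \<le> nsq F"
      using blaschke_split_nsq [OF U(1) b] blaschke_split_nsq [OF V2 c] IH(2) by (simp add: V0)
    moreover have "G * fps_of_poly (den_poly (l # \<sigma>)) = fps_of_poly P"
    proof -
      have "G * fps_of_poly (den_poly (l # \<sigma>)) = G * fps_of_poly [:1, - cnj l:] * fps_of_poly (den_poly \<sigma>)"
        by (simp only: den_poly_simps fps_of_poly_mult mult.assoc)
      also have "\<dots> = fps_const a * fps_of_poly (den_poly \<sigma>) + fps_of_poly [:l, -1:] * (G1 * fps_of_poly (den_poly \<sigma>))"
        unfolding G_eq by (simp only: distrib_right mult.assoc)
      finally show ?thesis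
        by (simp only: IH(4) P_def fps_of_poly_add fps_of_poly_mult fps_of_poly_smult)
    qed
    moreover have "coeff P k = 0" if "k \<ge> length (l # \<sigma>)" for k
    proof -
      obtain j where k: "k = Suc j" "j \<ge> length \<sigma>"
        using \<open>k \<ge> length (l # \<sigma>)\<close> by (cases k) auto
      have "coeff (den_poly \<sigma>) k = 0"
        using degree_den_poly [of \<sigma>] k by (intro coeff_eq_0) linarith
      then show ?thesis using IH(5) k by (simp add: P_def)
    qed
    moreover have "(F - G) * fps_of_poly (den_poly (l # \<sigma>)) = fps_of_poly (num_poly (l # \<sigma>)) * D"
    proof -
      have "(F - G) * fps_of_poly (den_poly (l # \<sigma>))
          = (F * fps_of_poly [:1, - cnj l:] - G * fps_of_poly [:1, - cnj l:]) * fps_of_poly (den_poly \<sigma>)"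
        by (simp only: den_poly_simps fps_of_poly_mult left_diff_distrib mult.assoc)
      also have "\<dots> = fps_of_poly [:l, -1:] * ((F1 - G1) * fps_of_poly (den_poly \<sigma>))"
        unfolding F_eq G_eq by (simp only: algebra_simps)
      finally show ?thesis by (simp only: IH(6) num_poly_simps fps_of_poly_mult mult.assoc)
    qed
    ultimately show ?case using IH(1) blaschke_split_l2(1) [OF V2 c] by blast
  qed
  then show ?thesis using that by blast
qed

subsection \<open>Power series expansions and rational functions\<close>

lemma fps_nth_expansion_tcoeff: "fps_nth (fps_expansion f 0) k = tcoeff f k"
  by (simp add: fps_expansion_def tcoeff_def)

lemma in_wspace_H2_iff: "in_wspace w_H2 f \<longleftrightarrow> f holomorphic_on ball 0 1 \<and> l2 (fps_expansion f 0)"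
  by (simp add: in_wspace_def hol_disc_def l2_def w_H2_def fps_nth_expansion_tcoeff)

lemma wnorm_H2: "wnorm w_H2 f = sqrt (nsq (fps_expansion f 0))"
  by (simp add: wnorm_def nsq_def w_H2_def fps_nth_expansion_tcoeff)

text \<open>The radius of convergence exceeds 1, so the coefficients are absolutely summable, and
  the l1 norm dominates the l2 norm.\<close>

lemma l2_fps_expansion:
  assumes "f holomorphic_on ball 0 R" "R > 1"
  shows "l2 (fps_expansion f 0)"
proof -
  let ?E = "fps_expansion f 0"
  have "fps_conv_radius ?E \<ge> ereal R"
    by (rule conv_radius_fps_expansion) (use assms in simp)
  then have "ereal (norm (1 :: complex)) < fps_conv_radius ?E"
    using assms(2) by (auto intro: less_le_trans [of _ "ereal R"])
  from norm_summable_fps [OF this] have sm: "summable (\<lambda>k. cmod (fps_nth ?E k))" by simp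
  show ?thesis
  proof (rule l2_I)
    fix N
    have "L2_set (\<lambda>k. cmod (fps_nth ?E k)) {..<N} \<le> (\<Sum>k<N. cmod (fps_nth ?E k))"
      by (rule L2_set_le_sum) simp
    also have "\<dots> \<le> (\<Sum>k. cmod (fps_nth ?E k))"
      by (rule sum_le_suminf [OF sm]) auto
    finally show "L2_set (\<lambda>k. cmod (fps_nth ?E k)) {..<N} \<le> (\<Sum>k. cmod (fps_nth ?E k))" .
  qed
qed

lemma poly_den_poly: "poly (den_poly \<sigma>) z = prod_list (map (\<lambda>l. 1 - cnj l * z) \<sigma>)"
  by (induction \<sigma>) (simp_all add: algebra_simps)

lemma poly_num_poly: "poly (num_poly \<sigma>) z = prod_list (map (\<lambda>l. l - z) \<sigma>)"
  by (induction \<sigma>) (simp_all add: algebra_simps)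

lemma poly_den_poly_nonzero:
  assumes "\<forall>l\<in>set \<sigma>. cmod l \<le> r" "r * cmod z < 1"
  shows "poly (den_poly \<sigma>) z \<noteq> 0"
proof -
  have "1 - cnj l * z \<noteq> 0" if "l \<in> set \<sigma>" for l
  proof
    assume "1 - cnj l * z = 0"
    then have "cmod l * cmod z = 1"
      by (metis complex_mod_cnj eq_iff_diff_eq_0 norm_mult norm_one)
    moreover have "cmod l * cmod z \<le> r * cmod z"
      using assms(1) that by (intro mult_right_mono) auto
    ultimately show False using assms(2) by simp
  qed
  then show ?thesis by (simp add: poly_den_poly prod_list_zero_iff) force
qed

lemma blaschke_quotient: "blaschke \<sigma> z = poly (num_poly \<sigma>) z / poly (den_poly \<sigma>) z"
  unfolding poly_num_poly poly_den_poly blaschke_def blaschke_fac_def by (induction \<sigma>) simp_all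

lemma
  fixes p :: "complex poly"
  assumes \<sigma>: "\<forall>l\<in>set \<sigma>. cmod l \<le> r" and r: "0 \<le> r" "r < 1"
  defines "f \<equiv> \<lambda>z. poly p z / poly (den_poly \<sigma>) z"
  shows rational_holomorphic: "f holomorphic_on ball 0 1"
    and rational_l2: "l2 (fps_expansion f 0)"
    and rational_fps: "fps_expansion f 0 * fps_of_poly (den_poly \<sigma>) = fps_of_poly p"
proof -
  \<comment> \<open>Any radius strictly between 1 and \<open>1 / r\<close> would do: the poles
    \<open>1 / cnj l\<close> lie outside the disc of radius \<open>R\<close>.\<close>
  define R where "R = 2 / (1 + r)"
  have R: "R > 1" "r * R < 1" using r by (simp_all add: R_def field_simps)
  have nz: "poly (den_poly \<sigma>) z \<noteq> 0" if "z \<in> ball 0 R" for z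
  proof (rule poly_den_poly_nonzero [OF \<sigma>])
    have "r * cmod z \<le> r * R" using that r by (intro mult_left_mono) auto
    then show "r * cmod z < 1" using R by simp
  qed
  then have hol: "f holomorphic_on ball 0 R"
    unfolding f_def by (auto intro!: holomorphic_intros)
  then show "f holomorphic_on ball 0 1"
    using R by (auto intro: holomorphic_on_subset)
  show "l2 (fps_expansion f 0)" by (rule l2_fps_expansion [OF hol R(1)])
  have poly_exp: "(\<lambda>z. poly q z) has_fps_expansion fps_of_poly q" for q :: "complex poly"
    by (simp add: has_fps_expansion_def)
  have "(\<lambda>z. f z * poly (den_poly \<sigma>) z) has_fps_expansion (fps_expansion f 0 * fps_of_poly (den_poly \<sigma>))"
    by (intro has_fps_expansion_mult poly_exp has_fps_expansion_fps_expansion [OF _ _ hol]) (use R in auto)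
  moreover have "\<forall>\<^sub>F z in nhds 0. f z * poly (den_poly \<sigma>) z = poly p z"
    using eventually_nhds_in_open [of "ball 0 R" "0 :: complex"] R
    by (auto simp: f_def nz elim!: eventually_mono)
  ultimately have "(\<lambda>z. poly p z) has_fps_expansion (fps_expansion f 0 * fps_of_poly (den_poly \<sigma>))"
    by (subst (asm) has_fps_expansion_cong [OF _ refl])
  then show "fps_expansion f 0 * fps_of_poly (den_poly \<sigma>) = fps_of_poly p"
    by (rule fps_expansion_unique_complex [OF _ poly_exp])
qed

lemma RnrE:
  assumes "f \<in> Rnr n r" "n \<ge> 1"
  obtains \<sigma> p where "length \<sigma> = n" "\<forall>l\<in>set \<sigma>. cmod l \<le> r" "\<And>k. k \<ge> n \<Longrightarrow> coeff p k = 0"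
    "f = (\<lambda>z. poly p z / poly (den_poly \<sigma>) z)"
proof -
  obtain p lam where *: "degree p \<le> n - 1" "\<forall>j<n. cmod (lam j) \<le> r"
    "f = (\<lambda>z. poly p z / (\<Prod>j<n. 1 - cnj (lam j) * z))"
    using assms(1) by (auto simp: Rnr_def)
  show ?thesis
  proof (rule that [of "map lam [0..<n]" p])
    show "coeff p k = 0" if "k \<ge> n" for k
      using *(1) assms(2) that by (intro coeff_eq_0) linarith
    show "f = (\<lambda>z. poly p z / poly (den_poly (map lam [0..<n])) z)"
      by (simp add: *(3) poly_den_poly prod.list_conv_set_nth atLeast0LessThan)
  qed (use * in auto)
qed

lemma RnrI:
  assumes "length \<sigma> \<le> n" "\<forall>l\<in>set \<sigma>. cmod l \<le> r" "0 \<le> r" "\<And>k. k \<ge> length \<sigma> \<Longrightarrow> coeff p k = 0"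
  shows "(\<lambda>z. poly p z / poly (den_poly \<sigma>) z) \<in> Rnr n r"
proof -
  \<comment> \<open>Missing parameters are filled with 0, which contributes the factor 1.\<close>
  define lam where "lam j = (if j < length \<sigma> then \<sigma> ! j else 0)" for j
  have "poly (den_poly \<sigma>) z = (\<Prod>j<n. 1 - cnj (lam j) * z)" for z
  proof -
    have "(\<Prod>j<n. 1 - cnj (lam j) * z) = (\<Prod>j<length \<sigma>. 1 - cnj (lam j) * z)"
      by (rule prod.mono_neutral_right) (use assms(1) in \<open>auto simp: lam_def\<close>)
    then show ?thesis
      by (simp add: poly_den_poly prod.list_conv_set_nth atLeast0LessThan lam_def)
  qed
  moreover have "degree p \<le> n - 1"
    using assms(1,4) by (intro degree_le) auto
  moreover have "\<forall>j<n. cmod (lam j) \<le> r"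
    using assms(2,3) by (auto simp: lam_def)
  ultimately show ?thesis unfolding Rnr_def by auto
qed

section \<open>Norms of rational functions and of their derivatives\<close>

lemma tcoeff_deriv: "tcoeff (deriv f) k = of_nat (Suc k) * tcoeff f (Suc k)"
proof -
  have "of_nat (Suc k) \<noteq> (0 :: complex)" by (rule of_nat_neq_0)
  then show ?thesis
    unfolding tcoeff_def fact_Suc of_nat_mult by (simp add: funpow_swap1 del: of_nat_Suc)
qed

text \<open>The Bergman weight cancels one of the two factors \<open>k + 1\<close> produced by
  differentiation, leaving the sum of \<open>k\<close> times the squared coefficients; adding the
  Hardy norm raises \<open>k\<close> to \<open>k + 1\<close>.\<close>

lemma
  assumes H: "l2 (fps_expansion f 0)" and D: "summable (\<lambda>k. w_Dir k * (cmod (tcoeff f k))\<^sup>2)"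
  shows wnorm_La2_deriv_nonneg: "0 \<le> wnorm w_La2 (deriv f)"
    and wnorm_Dir_decomp: "(wnorm w_Dir f)\<^sup>2 = (wnorm w_La2 (deriv f))\<^sup>2 + nsq (fps_expansion f 0)"
proof -
  let ?t = "\<lambda>k. (cmod (tcoeff f k))\<^sup>2"
  have H': "summable ?t" using H by (simp add: l2_def fps_nth_expansion_tcoeff)
  have t: "(\<lambda>k. real k * ?t k) = (\<lambda>k. w_Dir k * ?t k - ?t k)"
    by (auto simp: w_Dir_def algebra_simps)
  have S: "summable (\<lambda>k. real k * ?t k)"
    unfolding t by (intro summable_diff D H')
  have w: "w_La2 k * (cmod (tcoeff (deriv f) k))\<^sup>2 = real (Suc k) * ?t (Suc k)" for k
    by (simp add: tcoeff_deriv norm_mult power_mult_distrib w_La2_def power2_eq_square add.commute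
        del: of_nat_Suc) (simp add: field_simps)
  have "(\<Sum>k. w_La2 k * (cmod (tcoeff (deriv f) k))\<^sup>2) = (\<Sum>k. real k * ?t k)"
    unfolding w using suminf_split_head [OF S] by simp
  moreover have "(\<Sum>k. w_Dir k * ?t k) = (\<Sum>k. real k * ?t k) + (\<Sum>k. ?t k)"
    using suminf_add [OF S H'] by (simp add: w_Dir_def distrib_right)
  moreover have "0 \<le> (\<Sum>k. real k * ?t k)" "0 \<le> (\<Sum>k. ?t k)"
    by (intro suminf_nonneg S H'; simp)+
  ultimately show "0 \<le> wnorm w_La2 (deriv f)"
    "(wnorm w_Dir f)\<^sup>2 = (wnorm w_La2 (deriv f))\<^sup>2 + nsq (fps_expansion f 0)"
    by (simp_all add: wnorm_def nsq_def fps_nth_expansion_tcoeff)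
qed

lemma
  assumes f: "f \<in> Rnr n r" and n: "n \<ge> 1" and r: "0 \<le> r" "r < 1"
  shows Rnr_holomorphic: "f holomorphic_on ball 0 1"
    and Rnr_l2: "l2 (fps_expansion f 0)"
    and Rnr_summable_Dir: "summable (\<lambda>k. w_Dir k * (cmod (tcoeff f k))\<^sup>2)"
    and Rnr_Bernstein: "(wnorm w_Dir f)\<^sup>2 \<le> real n * ((1 + r) / (1 - r)) * nsq (fps_expansion f 0)"
proof -
  obtain \<sigma> p where \<sigma>: "length \<sigma> = n" "\<forall>l\<in>set \<sigma>. cmod l \<le> r" "\<And>k. k \<ge> n \<Longrightarrow> coeff p k = 0"
    and f_eq: "f = (\<lambda>z. poly p z / poly (den_poly \<sigma>) z)"
    using RnrE [OF f n] by blast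
  show "f holomorphic_on ball 0 1" and l2: "l2 (fps_expansion f 0)"
    unfolding f_eq by (rule rational_holomorphic rational_l2; use \<sigma> r in simp)+
  let ?B = "real n * ((1 + r) / (1 - r)) * nsq (fps_expansion f 0)"
  have le: "(\<Sum>k<N. w_Dir k * (cmod (tcoeff f k))\<^sup>2) \<le> ?B" for N
    using model_space_dirichlet [OF r(2) \<sigma>(2) l2 rational_fps [OF \<sigma>(2) r, of p, folded f_eq]] \<sigma>
    by (simp add: w_Dir_def fps_nth_expansion_tcoeff)
  show sm: "summable (\<lambda>k. w_Dir k * (cmod (tcoeff f k))\<^sup>2)"
    by (rule summableI_nonneg_bounded [OF _ le]) (simp add: w_Dir_def)
  have "(\<Sum>k. w_Dir k * (cmod (tcoeff f k))\<^sup>2) \<le> ?B"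
    by (rule suminf_le_const [OF sm le])
  moreover have "0 \<le> (\<Sum>k. w_Dir k * (cmod (tcoeff f k))\<^sup>2)"
    by (rule suminf_nonneg [OF sm]) (simp add: w_Dir_def)
  ultimately show "(wnorm w_Dir f)\<^sup>2 \<le> ?B" by (simp add: wnorm_def)
qed

text \<open>Justifies dividing by the Hardy norm: a holomorphic function whose Taylor coefficients
  all vanish is zero on the disc.\<close>

lemma nsq_pos:
  assumes "f holomorphic_on ball 0 1" "l2 (fps_expansion f 0)" "\<exists>z\<in>ball 0 1. f z \<noteq> 0"
  shows "nsq (fps_expansion f 0) > 0"
proof (rule ccontr)
  assume "\<not> ?thesis"
  then have "nsq (fps_expansion f 0) = 0" using nsq_nonneg [OF assms(2)] by simp
  then have "fps_expansion f 0 = 0"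
    using assms(2) suminf_eq_zero_iff [of "\<lambda>k. (cmod (fps_nth (fps_expansion f 0) k))\<^sup>2"]
    by (auto simp: nsq_def l2_def fps_eq_iff)
  moreover have "eval_fps (fps_expansion f 0) z = f z" if "z \<in> ball 0 1" for z
    using eval_fps_expansion' [of f 0 1 z] assms(1) that by (simp add: one_ereal_def)
  ultimately show False using assms(3) by force
qed

lemma interpolation_by_Rnr:
  assumes \<sigma>: "length \<sigma> \<le> n" "\<forall>l\<in>set \<sigma>. cmod l \<le> r" and r: "0 \<le> r" "r < 1"
    and f: "in_wspace w_H2 f"
  obtains g where "g \<in> Rnr n r" "interp_eq \<sigma> g f" "nsq (fps_expansion g 0) \<le> nsq (fps_expansion f 0)"
proof -
  let ?F = "fps_expansion f 0"
  have fhol: "f holomorphic_on ball 0 1" and F: "l2 ?F" using f by (auto simp: in_wspace_H2_iff)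
  have \<sigma>1: "\<forall>l\<in>set \<sigma>. cmod l < 1" using \<sigma>(2) by (blast intro: le_less_trans [OF _ r(2)])
  obtain G D P where D: "l2 D" and le: "nsq G \<le> nsq ?F"
    and P: "G * fps_of_poly (den_poly \<sigma>) = fps_of_poly P" "\<forall>k \<ge> length \<sigma>. coeff P k = 0"
    and eq: "(?F - G) * fps_of_poly (den_poly \<sigma>) = fps_of_poly (num_poly \<sigma>) * D"
    by (rule model_space_interpolant [OF \<sigma>1 F]) (rule that)
  define g where "g = (\<lambda>z. poly P z / poly (den_poly \<sigma>) z)"
  note gfacts = rational_holomorphic [OF \<sigma>(2) r, of P, folded g_def]
    rational_l2 [OF \<sigma>(2) r, of P, folded g_def] rational_fps [OF \<sigma>(2) r, of P, folded g_def]
  have "poly (den_poly \<sigma>) 0 \<noteq> 0" by (rule poly_den_poly_nonzero [OF \<sigma>(2)]) simp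
  \<comment> \<open>Formal power series form an integral domain, so cancelling the denominator
    identifies \<open>G\<close> with the expansion of \<open>g\<close>.\<close>
  then have "fps_of_poly (den_poly \<sigma>) \<noteq> 0" by (metis fps_of_poly_0 fps_of_poly_eq_iff poly_0)
  then have G: "fps_expansion g 0 = G"
    using P(1) gfacts(3) by (metis mult_right_cancel)
  have rad: "ereal (cmod z) < fps_conv_radius X" if "l2 X" "z \<in> ball 0 1" for X z
    using l2_conv_radius [OF that(1)] that(2) by (auto intro: less_le_trans [of _ 1] simp: one_ereal_def)
  have "interp_eq \<sigma> g f"
    unfolding interp_eq_def
  proof (intro exI [of _ "eval_fps D"] conjI ballI)
    show "eval_fps D holomorphic_on ball 0 1"
      by (rule holomorphic_on_eval_fps) (use rad [OF D] in \<open>auto simp: in_eball_iff\<close>)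
    fix z :: complex
    assume z: "z \<in> ball 0 1"
    have ev: "eval_fps (fps_expansion h 0) z = h z" if "h holomorphic_on ball 0 1" for h
      using eval_fps_expansion' [of h 0 1 z] that z by (simp add: one_ereal_def)
    have "eval_fps ((?F - G) * fps_of_poly (den_poly \<sigma>)) z = (eval_fps ?F z - eval_fps G z) * poly (den_poly \<sigma>) z"
      using rad [OF F z] rad [OF gfacts(2) z] rad [OF l2_diff [OF F gfacts(2)] z]
      by (simp add: G eval_fps_mult eval_fps_diff)
    also have "\<dots> = (f z - g z) * poly (den_poly \<sigma>) z"
      using ev [OF fhol] ev [OF gfacts(1)] by (simp add: G)
    finally have "(f z - g z) * poly (den_poly \<sigma>) z = poly (num_poly \<sigma>) z * eval_fps D z"
      using rad [OF D z] by (simp add: eq eval_fps_mult)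
    moreover have "poly (den_poly \<sigma>) z \<noteq> 0"
    proof (rule poly_den_poly_nonzero [OF \<sigma>(2)])
      have "r * cmod z \<le> r * 1" using z r by (intro mult_left_mono) auto
      then show "r * cmod z < 1" using r by simp
    qed
    ultimately show "f z - g z = blaschke \<sigma> z * eval_fps D z"
      by (simp add: blaschke_quotient field_simps)
  qed
  moreover have "g \<in> Rnr n r" unfolding g_def using P(2) by (intro RnrI \<sigma> r(1)) simp
  ultimately show ?thesis using that le G by simp
qed

section \<open>The two inequalities\<close>

theorem theoremB:
  fixes n :: nat and r :: real
  assumes "n \<ge> 1" and "0 \<le> r" and "r < 1"
  shows "\<exists>c. Cnr n r w_La2 w_H2 = ereal c \<and>
           Inr n r w_H2 w_Dir \<le> ereal (sqrt (c\<^sup>2 + 1)) \<and>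
           sqrt (c\<^sup>2 + 1) \<le> sqrt (1 + r + 1 / sqrt (real n) + (1 - r) / real n) * sqrt (real n / (1 - r))"
proof -
  note n = assms(1) and r = assms(2,3)
  let ?S = "{f \<in> Rnr n r. \<exists>z \<in> ball 0 1. f z \<noteq> 0}"
  let ?q = "\<lambda>f. wnorm w_La2 (deriv f) / wnorm w_H2 f"
  \<comment> \<open>The constant of \<open>Rnr_Bernstein\<close>. Subtracting the Hardy part of the
    Dirichlet norm turns it into \<open>K - 1\<close> for the quotients \<open>?q\<close>.\<close>
  define K where "K = real n * ((1 + r) / (1 - r))"
  have decomp: "(wnorm w_Dir f)\<^sup>2 = (wnorm w_La2 (deriv f))\<^sup>2 + nsq (fps_expansion f 0)"
    if "f \<in> Rnr n r" for f
    using Rnr_l2 [OF that n r] Rnr_summable_Dir [OF that n r] by (rule wnorm_Dir_decomp)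
  have pos: "nsq (fps_expansion f 0) > 0" if "f \<in> ?S" for f
    using that Rnr_holomorphic [OF _ n r] Rnr_l2 [OF _ n r] by (intro nsq_pos) auto
  have La2_nonneg: "0 \<le> wnorm w_La2 (deriv f)" if "f \<in> Rnr n r" for f
    using Rnr_l2 [OF that n r] Rnr_summable_Dir [OF that n r] by (rule wnorm_La2_deriv_nonneg)
  have q_bound: "?q f \<le> sqrt (K - 1)" if f: "f \<in> ?S" for f
  proof (rule real_le_rsqrt)
    let ?N = "nsq (fps_expansion f 0)"
    have "(wnorm w_La2 (deriv f))\<^sup>2 \<le> (K - 1) * ?N"
      using decomp [of f] Rnr_Bernstein [OF _ n r, of f] f by (simp add: K_def left_diff_distrib)
    then show "(?q f)\<^sup>2 \<le> K - 1"
      using pos [OF f] by (simp add: wnorm_H2 power_divide field_simps)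
  qed
  \<comment> \<open>The constant 1 keeps the supremum away from minus infinity and makes
    \<open>c\<close> nonnegative.\<close>
  have one: "(\<lambda>_. 1) \<in> ?S"
  proof -
    have "(\<lambda>z. poly 1 z / poly (den_poly [0]) z) \<in> Rnr n r"
      using n r by (intro RnrI) auto
    then show ?thesis by (auto intro: exI [of _ 0])
  qed
  have bdd: "bdd_above (?q ` ?S)" by (rule bdd_aboveI2 [OF q_bound])
  define c where "c = (SUP f\<in>?S. ?q f)"
  have C: "Cnr n r w_La2 w_H2 = ereal c"
  proof -
    have "(SUP f\<in>?S. ereal (?q f)) \<le> ereal (sqrt (K - 1))"
      using q_bound by (intro SUP_least) auto
    moreover have "ereal (?q (\<lambda>_. 1)) \<le> (SUP f\<in>?S. ereal (?q f))"
      by (rule SUP_upper [OF one])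
    ultimately have "\<bar>SUP f\<in>?S. ereal (?q f)\<bar> \<noteq> \<infinity>" by auto
    then show ?thesis
      unfolding Cnr_def c_def by (rule ereal_SUP [symmetric])
  qed
  have qc: "?q f \<le> c" if "f \<in> ?S" for f
    unfolding c_def by (rule cSUP_upper [OF that bdd])
  have "0 \<le> ?q f" if "f \<in> ?S" for f
    using La2_nonneg that pos [OF that] by (intro divide_nonneg_pos) (auto simp: wnorm_H2)
  from this [OF one] have "0 \<le> ?q (\<lambda>_. 1)" .
  then have c0: "0 \<le> c" using qc [OF one] by linarith
  have cK: "c \<le> sqrt (K - 1)"
    unfolding c_def by (rule cSUP_least [OF _ q_bound]) (use one in blast)
  have Dir_le: "wnorm w_Dir g \<le> sqrt (c\<^sup>2 + 1)" if g: "g \<in> Rnr n r" and N: "nsq (fps_expansion g 0) \<le> 1" for g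
  proof -
    let ?N = "nsq (fps_expansion g 0)"
    have N0: "0 \<le> ?N" by (rule nsq_nonneg [OF Rnr_l2 [OF g n r]])
    have "(wnorm w_Dir g)\<^sup>2 \<le> (c\<^sup>2 + 1) * ?N"
    proof (cases "g \<in> ?S")
      case True
      have "wnorm w_La2 (deriv g) \<le> c * sqrt ?N"
        using qc [OF True] pos [OF True] by (simp add: wnorm_H2 field_simps)
      then have "(wnorm w_La2 (deriv g))\<^sup>2 \<le> (c * sqrt ?N)\<^sup>2"
        using La2_nonneg [OF g] by (rule power_mono)
      then show ?thesis
        using decomp [OF g] N0 by (simp add: power_mult_distrib algebra_simps)
    next
      \<comment> \<open>Functions vanishing on the disc are excluded from the supremum and are
        treated separately.\<close>
      case False
      then have z: "g z = 0" if "z \<in> ball 0 1" for z using g that by auto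
      have "\<forall>\<^sub>F z in nhds 0. g z = 0"
        using eventually_nhds_in_open [of "ball 0 1" "0 :: complex"] by (auto simp: z elim!: eventually_mono)
      then have "fps_expansion g 0 = fps_expansion (\<lambda>_. 0) 0" by (rule fps_expansion_cong)
      also have "\<dots> = 0" by (rule fps_expansion_eqI) simp
      finally have "nsq (fps_expansion g 0) = 0" by (simp add: nsq_def)
      then show ?thesis using Rnr_Bernstein [OF g n r] by simp
    qed
    also have "\<dots> \<le> (c\<^sup>2 + 1) * 1" by (intro mult_left_mono N) simp
    finally show ?thesis by (simp add: real_le_rsqrt)
  qed
  have "Inr n r w_H2 w_Dir \<le> ereal (sqrt (c\<^sup>2 + 1))"
    unfolding Inr_def Iint_def
  proof (intro SUP_least)
    fix \<sigma> f
    assume \<sigma>: "\<sigma> \<in> {\<sigma>. length \<sigma> \<le> n \<and> (\<forall>l\<in>set \<sigma>. cmod l \<le> r)}"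
      and f: "f \<in> {f. in_wspace w_H2 f \<and> wnorm w_H2 f \<le> 1}"
    obtain g where g: "g \<in> Rnr n r" "interp_eq \<sigma> g f" "nsq (fps_expansion g 0) \<le> nsq (fps_expansion f 0)"
      using interpolation_by_Rnr [of \<sigma> n r f] \<sigma> f r by auto
    have "nsq (fps_expansion f 0) \<le> 1" using f by (simp add: wnorm_H2)
    then have "wnorm w_Dir g \<le> sqrt (c\<^sup>2 + 1)" using Dir_le g by simp
    moreover have "in_wspace w_Dir g"
      using Rnr_holomorphic [OF g(1) n r] Rnr_summable_Dir [OF g(1) n r]
      by (simp add: in_wspace_def hol_disc_def)
    ultimately show "(INF g \<in> {g. in_wspace w_Dir g \<and> interp_eq \<sigma> g f}. ereal (wnorm w_Dir g)) \<le> ereal (sqrt (c\<^sup>2 + 1))"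
      using g(2) by (intro INF_lower2 [of g]) auto
  qed
  moreover have "sqrt (c\<^sup>2 + 1) \<le> sqrt (1 + r + 1 / sqrt (real n) + (1 - r) / real n) * sqrt (real n / (1 - r))"
  proof -
    \<comment> \<open>The real \<open>sqrt\<close> is negative at negative arguments, so this yields
      \<open>1 \<le> K\<close>, and squaring then removes the root.\<close>
    have "0 \<le> sqrt (K - 1)" using c0 cK by linarith
    then have "c\<^sup>2 + 1 \<le> K" using power_mono [OF cK c0, of 2] by simp
    also have "K = (1 + r) * (real n / (1 - r))" by (simp add: K_def)
    \<comment> \<open>The bound by \<open>K\<close> is already stronger; the two added terms are
      nonnegative.\<close>
    also have "\<dots> \<le> (1 + r + 1 / sqrt (real n) + (1 - r) / real n) * (real n / (1 - r))"
      using r by (intro mult_right_mono) auto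
    finally show ?thesis by (simp add: real_sqrt_mult [symmetric] del: real_sqrt_mult)
  qed
  ultimately show ?thesis using C by blast
qed

end
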